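(* If there exists a polynomial-time algorithm for the restriction of the $\mathrm{Schrijver}$ problem to colorings of $S(n,k)$ with $n=4k$, then there exists a polynomial-time algorithm for the $\mathrm{Schrijver}(n,k,m)$ problem where $m=\lfloor n/2\rfloor-2k+1$ (algorithms being in the black-box input model).
   Context: Write $[n]=\{1,\ldots,n\}$. A subset of $[n]$ is stable if it contains no two consecutive elements and does not contain both $1$ and $n$. Let $\binom{[n]}{k}_{\mathrm{stab}}$ be the family of stable $k$-subsets of $[n]$. For positive integers $n\ge 2k$, the Schrijver graph $S(n,k)$ has vertex set $\binom{[n]}{k}_{\mathrm{stab}}$, with two sets adjacent if and only if they are disjoint. For a function $m=m(n,k)$, the search problem $\mathrm{Schrijver}(n,k,m)$ is: given positive integers $n,k$ with $n\ge 2k$ and a (not necessarily proper) coloring $c:\binom{[n]}{k}_{\mathrm{stab}}\to[m]$ with $m=m(n,k)$ colors, find a monochromatic edge of $S(n,k)$, i.e., $A,B\in\binom{[n]}{k}_{\mathrm{stab}}$ with $A\cap B=\emptyset$ and $c(A)=c(B)$. The problem $\mathrm{Schrijver}$ is $\mathrm{Schrijver}(n,k,n-2k+1)$. In the black-box input model, the coloring $c$ is given by an oracle which returns $c(A)$ when queried on a vertex $A$. An algorithm is polynomial-time if its running time (including oracle queries) is polynomial in $n$. *)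

theory Defs
  imports Complex_Main "HOL-Library.FuncSet" "HOL-Computational_Algebra.Polynomial"
begin

definition stable :: "nat \<Rightarrow> nat set \<Rightarrow> bool" where
  "stable n A \<longleftrightarrow> A \<subseteq> {1..n} \<and> (\<forall>i. \<not> (i \<in> A \<and> Suc i \<in> A)) \<and> \<not> (1 \<in> A \<and> n \<in> A)"

definition schrijver_verts :: "nat \<Rightarrow> nat \<Rightarrow> nat set set" where
  "schrijver_verts n k = {A. stable n A \<and> card A = k}"

definition schrijver_edges :: "nat \<Rightarrow> nat \<Rightarrow> (nat set \<times> nat set) set" where
  "schrijver_edges n k =
     {(A, B). A \<in> schrijver_verts n k \<and> B \<in> schrijver_verts n k \<and> A \<inter> B = {}}"

definition monochromatic_edge ::
    "nat \<Rightarrow> nat \<Rightarrow> (nat set \<Rightarrow> nat) \<Rightarrow> nat set \<Rightarrow> nat set \<Rightarrow> bool" where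
  "monochromatic_edge n k c A B \<longleftrightarrow> (A, B) \<in> schrijver_edges n k \<and> c A = c B"


subsection \<open>Programs with black-box access\<close>

text \<open>
  The model of computation: a program is a finite piece of control over finitely many registers,
  each holding a stack of bits (the head of the list is the top).  Every elementary operation and
  every test costs one time unit and touches only the top of one stack.  Since a tape is a pair of
  stacks, these are multitape Turing machines with query tapes and structured control, and running
  times agree up to polynomial factors.  As for such machines, a query costs one time unit in
  addition to the time spent writing it, and its answer can be inspected only bit by bit.
\<close>

type_synonym word = "bool list"
type_synonym state = "nat \<Rightarrow> word"
type_synonym black_box = "word \<Rightarrow> word option"

datatype prog =
    Skip
  | Push nat bool
  | Pop nat
  | Query nat nat
  | Seq prog prog
  | Branch nat prog prog prog
  | While nat prog

text \<open>
  \<open>exec bb p s t s'\<close>: with black box \<open>bb\<close>, program \<open>p\<close> started in state \<open>s\<close> halts after \<open>t\<close> steps in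
  state \<open>s'\<close>.  \<open>Query x y\<close> writes the answer to the query in register \<open>x\<close> to register \<open>y\<close>; if the
  black box has no answer (\<open>None\<close>), the program is stuck and has no terminating run.
  \<open>Branch x\<close> distinguishes whether register \<open>x\<close> is empty, has top \<open>False\<close>, or has top \<open>True\<close>.
  \<open>While x\<close> loops as long as register \<open>x\<close> is nonempty.
\<close>

inductive exec :: "black_box \<Rightarrow> prog \<Rightarrow> state \<Rightarrow> nat \<Rightarrow> state \<Rightarrow> bool" for bb :: black_box where
  exec_Skip: "exec bb Skip s 1 s"
| exec_Push: "exec bb (Push x b) s 1 (s(x := b # s x))"
| exec_Pop: "exec bb (Pop x) s 1 (s(x := tl (s x)))"
| exec_Query: "bb (s x) = Some w \<Longrightarrow> exec bb (Query x y) s 1 (s(y := w))"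
| exec_Seq: "exec bb p s t s' \<Longrightarrow> exec bb q s' u s'' \<Longrightarrow> exec bb (Seq p q) s (t + u) s''"
| exec_Branch_empty: "s x = [] \<Longrightarrow> exec bb p s t s' \<Longrightarrow> exec bb (Branch x p q r) s (t + 1) s'"
| exec_Branch_False:
    "s x = False # w \<Longrightarrow> exec bb q s t s' \<Longrightarrow> exec bb (Branch x p q r) s (t + 1) s'"
| exec_Branch_True:
    "s x = True # w \<Longrightarrow> exec bb r s t s' \<Longrightarrow> exec bb (Branch x p q r) s (t + 1) s'"
| exec_While_empty: "s x = [] \<Longrightarrow> exec bb (While x p) s 1 s"
| exec_While_step:
    "s x \<noteq> [] \<Longrightarrow> exec bb p s t s' \<Longrightarrow> exec bb (While x p) s' u s'' \<Longrightarrow>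
     exec bb (While x p) s (t + u + 1) s''"

inductive_cases exec_SkipE: "exec bb Skip s t s'"
inductive_cases exec_PushE: "exec bb (Push x b) s t s'"
inductive_cases exec_PopE: "exec bb (Pop x) s t s'"
inductive_cases exec_QueryE: "exec bb (Query x y) s t s'"
inductive_cases exec_SeqE: "exec bb (Seq p q) s t s'"
inductive_cases exec_BranchE: "exec bb (Branch x p q r) s t s'"
inductive_cases exec_WhileE: "exec bb (While x p) s t s'"

lemma exec_deterministic:
  assumes "exec bb p s t s'" and "exec bb p s u s''"
  shows "u = t \<and> s'' = s'"
  using assms
proof (induction arbitrary: u s'' rule: exec.induct)
  case (exec_Skip s)
  from exec_Skip.prems show ?case by (rule exec_SkipE) simp
next
  case (exec_Push x b s)
  from exec_Push.prems show ?case by (rule exec_PushE) simp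
next
  case (exec_Pop x s)
  from exec_Pop.prems show ?case by (rule exec_PopE) simp
next
  case (exec_Query s x w y)
  from exec_Query.prems show ?case by (rule exec_QueryE) (use exec_Query.hyps in simp)
next
  case (exec_Seq p s t s' q u s'' v r)
  from exec_Seq.prems show ?case by (rule exec_SeqE) (metis exec_Seq.IH)
next
  case (exec_Branch_empty s x p t s' q r)
  from exec_Branch_empty.prems show ?case
    by (rule exec_BranchE) (use exec_Branch_empty.hyps(1) in \<open>auto dest!: exec_Branch_empty.IH\<close>)
next
  case (exec_Branch_False s x w q t s' p r)
  from exec_Branch_False.prems show ?case
    by (rule exec_BranchE) (use exec_Branch_False.hyps(1) in \<open>auto dest!: exec_Branch_False.IH\<close>)
next
  case (exec_Branch_True s x w r t s' p q)
  from exec_Branch_True.prems show ?case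
    by (rule exec_BranchE) (use exec_Branch_True.hyps(1) in \<open>auto dest!: exec_Branch_True.IH\<close>)
next
  case (exec_While_empty s x p)
  from exec_While_empty.prems show ?case
    by (rule exec_WhileE) (use exec_While_empty.hyps in simp_all)
next
  case (exec_While_step s x p t s' u s'' v r)
  from exec_While_step.prems show ?case
    by (rule exec_WhileE)
      (use exec_While_step.hyps(1) in \<open>auto dest!: exec_While_step.IH\<close>)
qed


subsection \<open>The search problem in the black-box model\<close>

text \<open>
  A subset of \<open>{1..n}\<close> is written as its characteristic word of length \<open>n\<close>.  The numbers \<open>n\<close>,
  \<open>k\<close> and the colors are written in unary; as running times are measured in \<open>n\<close>, which bounds \<open>k\<close>
  and (for the color counts considered) all colors, binary notation would give the same notion of
  polynomial time.
\<close>

definition char_word :: "nat \<Rightarrow> nat set \<Rightarrow> word" where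
  "char_word n A = map (\<lambda>i. i \<in> A) [1..<Suc n]"

definition unary :: "nat \<Rightarrow> word" where
  "unary a = replicate a True"

lemma inj_on_char_word: "inj_on (char_word n) (schrijver_verts n k)"
proof (rule inj_onI)
  fix A B assume A: "A \<in> schrijver_verts n k" and B: "B \<in> schrijver_verts n k"
    and eq: "char_word n A = char_word n B"
  have sub: "A \<subseteq> {1..n}" "B \<subseteq> {1..n}"
    using A B by (auto simp: schrijver_verts_def stable_def)
  have "i \<in> A \<longleftrightarrow> i \<in> B" if "i \<in> {1..n}" for i
  proof -
    have "\<forall>j \<in> set [1..<Suc n]. (j \<in> A) = (j \<in> B)"
      using eq unfolding char_word_def map_eq_conv .
    moreover have "i \<in> set [1..<Suc n]"
      using that by auto
    ultimately show ?thesis by blast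
  qed
  with sub show "A = B" by blast
qed

text \<open>
  The black box answers queries on vertices only, so a correct algorithm never queries a non-vertex.
\<close>

definition coloring_black_box :: "nat \<Rightarrow> nat \<Rightarrow> (nat set \<Rightarrow> nat) \<Rightarrow> black_box" where
  "coloring_black_box n k c w =
     (if w \<in> char_word n ` schrijver_verts n k
      then Some (unary (c (the_inv_into (schrijver_verts n k) (char_word n) w)))
      else None)"

lemma coloring_black_box_vertex:
  "A \<in> schrijver_verts n k \<Longrightarrow> coloring_black_box n k c (char_word n A) = Some (unary (c A))"
  by (simp add: coloring_black_box_def the_inv_into_f_f[OF inj_on_char_word])

definition input_state :: "nat \<Rightarrow> nat \<Rightarrow> state" where
  "input_state n k = (\<lambda>_. [])(0 := unary n, 1 := unary k)"

text \<open>
  \<open>schrijver_poly_time I m\<close>: the problem Schrijver(n,k,m), restricted to those \<open>(n,k)\<close> satisfying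
  \<open>I\<close>, has a polynomial-time algorithm in the black-box input model.  The number of colors is
  integer-valued, and there are no inputs \<open>(n,k,c)\<close> with \<open>m n k \<le> 0\<close>, the set of colors being
  empty and the set of vertices nonempty.  The answer is returned in registers 0 and 1.
\<close>

definition schrijver_poly_time ::
    "(nat \<Rightarrow> nat \<Rightarrow> bool) \<Rightarrow> (nat \<Rightarrow> nat \<Rightarrow> int) \<Rightarrow> bool" where
  "schrijver_poly_time I m \<longleftrightarrow>
     (\<exists>(p :: prog) (T :: nat poly). \<forall>n k c.
        0 < k \<longrightarrow> 2 * k \<le> n \<longrightarrow> I n k \<longrightarrow>
        c \<in> schrijver_verts n k \<rightarrow> {1..nat (m n k)} \<longrightarrow>
        (\<exists>t s A B. exec (coloring_black_box n k c) p (input_state n k) t s \<and> t \<le> poly T n \<and>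
           s 0 = char_word n A \<and> s 1 = char_word n B \<and> monochromatic_edge n k c A B))"

end

theory Submission
  imports Defs
begin

text \<open>
  Let \<open>k' = n div 4\<close> and \<open>n' = 4 * k'\<close>.  There are no inputs unless \<open>4 * k \<le> n\<close>, and then
  \<open>k \<le> k'\<close>, so a stable \<open>k'\<close>-subset of \<open>[n']\<close> can be colored by the color of the set of its \<open>k\<close>
  largest elements, which is a stable \<open>k\<close>-subset of \<open>[n]\<close>.  This uses at most
  \<open>\<lfloor>n / 2\<rfloor> - 2 * k + 1 \<le> n' - 2 * k' + 1\<close> colors, and a monochromatic edge of \<open>S(n',k')\<close> yields one
  of \<open>S(n,k)\<close>, as disjointness passes to subsets.  On the level of programs, each query is
  replaced by a linear-time computation in fresh registers followed by a query of \<open>c\<close>.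
\<close>

section \<open>Time-bounded runs\<close>

text \<open>
  Induction leaves eta-expanded states in the goals, which \<open>fun_upd_apply\<close> would turn into
  case distinctions on register numbers.
\<close>

declare fun_upd_apply [simp del] fun_upd_same [simp] fun_upd_other [simp]

text \<open>Only an upper bound on the time is kept, so branches of unequal length need no balancing
  and estimates can be rounded up.\<close>

definition runs :: "black_box \<Rightarrow> prog \<Rightarrow> state \<Rightarrow> nat \<Rightarrow> state \<Rightarrow> bool" where
  "runs bb p s b s' \<longleftrightarrow> (\<exists>t\<le>b. exec bb p s t s')"

lemma runs_mono: "runs bb p s b s' \<Longrightarrow> b \<le> b' \<Longrightarrow> runs bb p s b' s'"
  unfolding runs_def by (meson order_trans)

lemma runs_Skip: "runs bb Skip s 1 s"
  and runs_Push: "runs bb (Push x b) s 1 (s(x := b # s x))"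
  and runs_Pop: "runs bb (Pop x) s 1 (s(x := tl (s x)))"
  unfolding runs_def by (blast intro: exec.intros)+

lemma runs_Query: "bb (s x) = Some w \<Longrightarrow> runs bb (Query x y) s 1 (s(y := w))"
  unfolding runs_def by (blast intro: exec.intros)

lemma runs_Seq:
  "runs bb p s a s' \<Longrightarrow> runs bb q s' b s'' \<Longrightarrow> runs bb (Seq p q) s (a + b) s''"
  unfolding runs_def by (meson add_mono exec_Seq)

lemma runs_Branch_empty:
  "s x = [] \<Longrightarrow> runs bb p s b s' \<Longrightarrow> runs bb (Branch x p q r) s (b + 1) s'"
  unfolding runs_def by (meson add_right_mono exec_Branch_empty)

lemma runs_Branch_False:
  "s x = False # w \<Longrightarrow> runs bb q s b s' \<Longrightarrow> runs bb (Branch x p q r) s (b + 1) s'"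
  unfolding runs_def by (meson add_right_mono exec_Branch_False)

lemma runs_Branch_True:
  "s x = True # w \<Longrightarrow> runs bb r s b s' \<Longrightarrow> runs bb (Branch x p q r) s (b + 1) s'"
  unfolding runs_def by (meson add_right_mono exec_Branch_True)

lemma runs_While_empty: "s x = [] \<Longrightarrow> runs bb (While x p) s 1 s"
  unfolding runs_def by (blast intro: exec.intros)

lemma runs_While_step:
  assumes "s x \<noteq> []" and "runs bb p s a s'" and "runs bb (While x p) s' b s''"
  shows "runs bb (While x p) s (a + b + 1) s''"
  using assms unfolding runs_def by (meson add_mono add_right_mono exec_While_step)

section \<open>Replacing the black box\<close>

fun regs :: "prog \<Rightarrow> nat set" where
  "regs Skip = {}"
| "regs (Push x b) = {x}"
| "regs (Pop x) = {x}"
| "regs (Query x y) = {x, y}"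
| "regs (Seq p q) = regs p \<union> regs q"
| "regs (Branch x p q r) = insert x (regs p \<union> regs q \<union> regs r)"
| "regs (While x p) = insert x (regs p)"

lemma finite_regs: "finite (regs p)"
  by (induction p) auto

fun subst_query :: "(nat \<Rightarrow> nat \<Rightarrow> prog) \<Rightarrow> prog \<Rightarrow> prog" where
  "subst_query f (Query x y) = f x y"
| "subst_query f (Seq p q) = Seq (subst_query f p) (subst_query f q)"
| "subst_query f (Branch x p q r) =
     Branch x (subst_query f p) (subst_query f q) (subst_query f r)"
| "subst_query f (While x p) = While x (subst_query f p)"
| "subst_query f p = p"

text \<open>Registers from \<open>M\<close> on are private to the simulating program;
  \<open>u\<close> is their content whenever a simulated instruction starts or ends.\<close>

definition with_upper :: "nat \<Rightarrow> state \<Rightarrow> state \<Rightarrow> state" where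
  "with_upper M u s = (\<lambda>r. if r < M then s r else u r)"

lemma with_upper_less [simp]: "r < M \<Longrightarrow> with_upper M u s r = s r"
  by (simp add: with_upper_def)

lemma with_upper_upd: "x < M \<Longrightarrow> with_upper M u (s(x := w)) = (with_upper M u s)(x := w)"
  by (auto simp: with_upper_def fun_upd_apply)

text \<open>Induction on the simulated run, with upper registers equal to \<open>u\<close> as the
  invariant, which the replacement of a query must restore. Each simulated step is charged
  \<open>C\<close>; as \<open>C\<close> is at least 1, this also pays for the unchanged commands and
  tests.\<close>

lemma runs_subst_query:
  assumes "exec bb' p s t s'" and "regs p \<subseteq> {..<M}" and "1 \<le> C"
    and query: "\<And>x y s w. x < M \<Longrightarrow> y < M \<Longrightarrow> bb' (s x) = Some w \<Longrightarrow>
      runs bb (f x y) (with_upper M u s) C (with_upper M u (s(y := w)))"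
  shows "runs bb (subst_query f p) (with_upper M u s) (C * t) (with_upper M u s')"
  using assms(1,2)
proof (induction rule: exec.induct)
  case (exec_Skip s)
  show ?case using runs_mono[OF runs_Skip] \<open>1 \<le> C\<close> by simp
next
  case (exec_Push x b s)
  then show ?case
    using runs_mono[OF runs_Push[of bb x b "with_upper M u s"]] \<open>1 \<le> C\<close>
    by (simp add: with_upper_upd)
next
  case (exec_Pop x s)
  then show ?case
    using runs_mono[OF runs_Pop[of bb x "with_upper M u s"]] \<open>1 \<le> C\<close>
    by (simp add: with_upper_upd)
next
  case (exec_Query s x w y)
  then show ?case using query[of x y s w] by simp
next
  case (exec_Seq p s t s' q v s'')
  then show ?case by (simp add: add_mult_distrib2 runs_Seq)
next
  case (exec_Branch_empty s x p t s' q r)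
  have "runs bb (subst_query f (Branch x p q r)) (with_upper M u s) (C * t + 1)
      (with_upper M u s')"
    unfolding subst_query.simps
    by (rule runs_Branch_empty) (use exec_Branch_empty in simp_all)
  then show ?case by (rule runs_mono) (use \<open>1 \<le> C\<close> in simp)
next
  case (exec_Branch_False s x w q t s' p r)
  have "runs bb (subst_query f (Branch x p q r)) (with_upper M u s) (C * t + 1)
      (with_upper M u s')"
    unfolding subst_query.simps
    by (rule runs_Branch_False[where w = w]) (use exec_Branch_False in simp_all)
  then show ?case by (rule runs_mono) (use \<open>1 \<le> C\<close> in simp)
next
  case (exec_Branch_True s x w r t s' p q)
  have "runs bb (subst_query f (Branch x p q r)) (with_upper M u s) (C * t + 1)
      (with_upper M u s')"
    unfolding subst_query.simps
    by (rule runs_Branch_True[where w = w]) (use exec_Branch_True in simp_all)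
  then show ?case by (rule runs_mono) (use \<open>1 \<le> C\<close> in simp)
next
  case (exec_While_empty s x p)
  have "runs bb (subst_query f (While x p)) (with_upper M u s) 1 (with_upper M u s)"
    unfolding subst_query.simps
    by (rule runs_While_empty) (use exec_While_empty in simp_all)
  then show ?case by (rule runs_mono) (use \<open>1 \<le> C\<close> in simp)
next
  case (exec_While_step s x p t s' v s'')
  have "runs bb (subst_query f (While x p)) (with_upper M u s) (C * t + C * v + 1)
      (with_upper M u s'')"
    unfolding subst_query.simps
    by (rule runs_While_step[where s' = "with_upper M u s'"]) (use exec_While_step in simp_all)
  then show ?case by (rule runs_mono) (use \<open>1 \<le> C\<close> in \<open>simp add: add_mult_distrib2\<close>)
qed

section \<open>Elementary programs\<close>

text \<open>Queries are excluded along with loops, so that time bound and final state are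
  independent of the black box and \<open>simp\<close> can execute loop bodies. The values of
  \<open>cost\<close> and \<open>result\<close> on \<open>Query\<close> and \<open>While\<close> are
  dummies.\<close>

fun loop_free :: "prog \<Rightarrow> bool" where
  "loop_free (Query x y) = False"
| "loop_free (While x p) = False"
| "loop_free (Seq p q) = (loop_free p \<and> loop_free q)"
| "loop_free (Branch x p q r) = (loop_free p \<and> loop_free q \<and> loop_free r)"
| "loop_free p = True"

fun cost :: "prog \<Rightarrow> nat" where
  "cost (Seq p q) = cost p + cost q"
| "cost (Branch x p q r) = max (cost p) (max (cost q) (cost r)) + 1"
| "cost p = 1"

fun result :: "prog \<Rightarrow> state \<Rightarrow> state" where
  "result (Push x b) s = s(x := b # s x)"
| "result (Pop x) s = s(x := tl (s x))"
| "result (Seq p q) s = result q (result p s)"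
| "result (Branch x p q r) s =
     (case s x of [] \<Rightarrow> result p s | b # w \<Rightarrow> if b then result r s else result q s)"
| "result p s = s"

lemma runs_loop_free: "loop_free p \<Longrightarrow> runs bb p s (cost p) (result p s)"
proof (induction p arbitrary: s)
  case Skip
  show ?case using runs_Skip by simp
next
  case (Push x b)
  show ?case using runs_Push[of bb x b s] by simp
next
  case (Pop x)
  show ?case using runs_Pop[of bb x s] by simp
next
  case (Seq p q)
  then show ?case by (auto intro: runs_Seq)
next
  case (Branch x p q r)
  then have IH: "runs bb p s (cost p) (result p s)" "runs bb q s (cost q) (result q s)"
    "runs bb r s (cost r) (result r s)"
    by simp_all
  consider "s x = []" | w where "s x = False # w" | w where "s x = True # w"
    by (metis (full_types) neq_Nil_conv)
  then show ?case
  proof cases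
    case 1
    show ?thesis by (rule runs_mono) (rule runs_Branch_empty[of s x, OF 1], use 1 IH in auto)
  next
    case 2
    show ?thesis by (rule runs_mono) (rule runs_Branch_False[of s x, OF 2], use 2 IH in auto)
  next
    case 3
    show ?thesis by (rule runs_mono) (rule runs_Branch_True[of s x, OF 3], use 3 IH in auto)
  qed
qed simp_all

lemma runs_While_loop_free:
  assumes "s x \<noteq> []" and "loop_free p" and "runs bb (While x p) (result p s) b s'"
    and "b' = cost p + b + 1"
  shows "runs bb (While x p) s b' s'"
  using runs_While_step[of s x bb p] assms runs_loop_free by blast

lemma runs_While_Nil: "s x = [] \<Longrightarrow> s' = s \<Longrightarrow> runs bb (While x p) s 1 s'"
  using runs_While_empty by simp

section \<open>Unary words and elementary loops\<close>

lemma rev_unary [simp]: "rev (unary a) = unary a"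
  and unary_0 [simp]: "unary 0 = []"
  and length_unary [simp]: "length (unary a) = a"
  and unary_append [simp]: "unary a @ unary b = unary (a + b)"
  by (simp_all add: unary_def replicate_add)

lemma unary_Suc: "unary (Suc a) = True # unary a"
  by (simp add: unary_def)

definition clear :: "nat \<Rightarrow> prog" where
  "clear x = While x (Pop x)"

lemma runs_clear: "runs bb (clear x) s (2 * length (s x) + 1) (s(x := []))"
proof (induction "s x" arbitrary: s)
  case Nil
  then show ?case by (auto simp: clear_def fun_eq_iff fun_upd_apply intro!: runs_While_Nil[unfolded One_nat_def])
next
  case (Cons b w)
  from Cons.hyps(1)[of "s(x := w)"] show ?case
    unfolding clear_def
    by - (rule runs_While_loop_free[where b = "2 * length w + 1"], simp_all flip: Cons.hyps(2))
qed

text \<open>Moving reverses a word: two moves restore its order, and a unary word, being a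
  palindrome, needs only one.\<close>

definition move :: "nat \<Rightarrow> nat \<Rightarrow> prog" where
  "move x y = While x (Branch x Skip (Seq (Pop x) (Push y False)) (Seq (Pop x) (Push y True)))"

lemma runs_move:
  "x \<noteq> y \<Longrightarrow> runs bb (move x y) s (4 * length (s x) + 1) (s(x := [], y := rev (s x) @ s y))"
proof (induction "s x" arbitrary: s)
  case Nil
  then show ?case by (auto simp: move_def fun_eq_iff fun_upd_apply intro!: runs_While_Nil[unfolded One_nat_def])
next
  case (Cons b w)
  let ?s = "s(x := w, y := b # s y)"
  have "runs bb (move x y) ?s (4 * length w + 1) (?s(x := [], y := rev w @ b # s y))"
    using Cons.hyps(1)[of ?s] Cons.prems by simp
  moreover have "?s(x := [], y := rev w @ b # s y) = s(x := [], y := rev (s x) @ s y)"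
    using Cons.prems by (auto simp: fun_eq_iff fun_upd_apply simp flip: Cons.hyps(2))
  ultimately show ?case
    using Cons.prems unfolding move_def
    by - (cases b; rule runs_While_loop_free[where b = "4 * length w + 1"];
        simp flip: Cons.hyps(2))
qed

text \<open>The counter is transferred to \<open>y\<close> rather than discarded, so that it can be
  moved back for the next query.\<close>

definition pad :: "nat \<Rightarrow> nat \<Rightarrow> nat \<Rightarrow> prog" where
  "pad x y z = While x (Seq (Pop x) (Seq (Push y True) (Push z False)))"

lemma runs_pad:
  assumes "distinct [x, y, z]" and "s x = unary d" and "s y = unary e"
  shows "runs bb (pad x y z) s (4 * d + 1)
    (s(x := [], y := unary (d + e), z := replicate d False @ s z))"
proof -
  \<comment> \<open>The reversed list gives the simplifier each inequality in the other
    orientation.\<close>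
  have distinct: "distinct [x, y, z]" "distinct [z, y, x]"
    using assms(1) by auto
  show ?thesis
    using assms(2,3)
  proof (induction d arbitrary: s e)
    case 0
    then show ?case by (auto simp: pad_def fun_eq_iff fun_upd_apply intro!: runs_While_Nil[unfolded One_nat_def])
  next
    case (Suc d)
    let ?s = "s(x := unary d, y := unary (Suc e), z := False # s z)"
    have "runs bb (pad x y z) ?s (4 * d + 1)
        (?s(x := [], y := unary (d + Suc e), z := replicate d False @ False # s z))"
      using Suc.IH[of ?s "Suc e"] distinct by simp
    moreover have "?s(x := [], y := unary (d + Suc e), z := replicate d False @ False # s z)
        = s(x := [], y := unary (Suc d + e), z := replicate (Suc d) False @ s z)"
      using distinct by (auto simp: fun_eq_iff fun_upd_apply replicate_app_Cons_same)
    ultimately show ?case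
      using Suc.prems distinct unfolding pad_def
      by - (rule runs_While_loop_free[where b = "4 * d + 1"], simp_all add: unary_Suc)
  qed
qed

text \<open>On a reversed characteristic word this retains the \<open>j\<close> largest elements; a
  surplus \<open>True\<close> becomes \<open>False\<close>, so all positions are preserved.\<close>

fun keep_True :: "nat \<Rightarrow> word \<Rightarrow> word" where
  "keep_True j [] = []"
| "keep_True j (False # w) = False # keep_True j w"
| "keep_True 0 (True # w) = False # keep_True 0 w"
| "keep_True (Suc j) (True # w) = True # keep_True j w"

text \<open>
  In \<open>keep\<close>, the word is read from \<open>r\<close> and moved back to \<open>x\<close>, the result is pushed onto \<open>z\<close>, and the
  budget \<open>j\<close> is consumed from \<open>a\<close> into \<open>b\<close>, from where it can be restored.
\<close>

definition keep :: "nat \<Rightarrow> nat \<Rightarrow> nat \<Rightarrow> nat \<Rightarrow> nat \<Rightarrow> prog" where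
  "keep r x z a b = While r (Branch r Skip
     (Seq (Pop r) (Seq (Push x False) (Push z False)))
     (Seq (Pop r) (Seq (Push x True)
       (Branch a (Push z False) Skip (Seq (Pop a) (Seq (Push b True) (Push z True)))))))"

text \<open>The recursion of \<open>keep_True\<close> makes the same case distinction as the loop
  body. Every bit is charged the longest path: 7 for the body and 1 for the loop test.\<close>

lemma runs_keep:
  assumes "distinct [r, x, z, a, b]" and "s r = w" and "s a = unary j" and "s b = unary i"
  shows "runs bb (keep r x z a b) s (8 * length w + 1)
    (s(r := [], x := rev w @ s x, z := rev (keep_True j w) @ s z,
       a := unary (j - count_list w True), b := unary (i + min j (count_list w True))))"
proof -
  have distinct: "distinct [r, x, z, a, b]" "distinct [b, a, z, x, r]"
    using assms(1) by auto
  show ?thesis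
    using assms(2-)
  proof (induction j w arbitrary: s i rule: keep_True.induct)
    case (1 j)
    then show ?case by (auto simp: keep_def fun_eq_iff fun_upd_apply intro!: runs_While_Nil[unfolded One_nat_def])
  next
    case (2 j w)
    let ?s = "s(r := w, x := False # s x, z := False # s z)"
    have "runs bb (keep r x z a b) ?s (8 * length w + 1)
        (?s(r := [], x := rev w @ ?s x, z := rev (keep_True j w) @ ?s z,
         a := unary (j - count_list w True), b := unary (i + min j (count_list w True))))"
      by (rule "2.IH") (use distinct "2.prems" in auto)
    moreover have "?s(r := [], x := rev w @ ?s x, z := rev (keep_True j w) @ ?s z,
         a := unary (j - count_list w True), b := unary (i + min j (count_list w True)))
       = s(r := [], x := rev (False # w) @ s x, z := rev (keep_True j (False # w)) @ s z,
         a := unary (j - count_list (False # w) True),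
         b := unary (i + min j (count_list (False # w) True)))"
      using distinct by (auto simp: fun_eq_iff fun_upd_apply)
    ultimately show ?case
      using "2.prems" distinct unfolding keep_def
      by - (rule runs_While_loop_free[where b = "8 * length w + 1"], simp_all)
  next
    case (3 w)
    let ?s = "s(r := w, x := True # s x, z := False # s z)"
    have "runs bb (keep r x z a b) ?s (8 * length w + 1)
        (?s(r := [], x := rev w @ ?s x, z := rev (keep_True 0 w) @ ?s z,
         a := unary (0 - count_list w True), b := unary (i + min 0 (count_list w True))))"
      by (rule "3.IH") (use distinct "3.prems" in auto)
    moreover have "?s(r := [], x := rev w @ ?s x, z := rev (keep_True 0 w) @ ?s z,
         a := unary (0 - count_list w True), b := unary (i + min 0 (count_list w True)))
       = s(r := [], x := rev (True # w) @ s x, z := rev (keep_True 0 (True # w)) @ s z,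
         a := unary (0 - count_list (True # w) True),
         b := unary (i + min 0 (count_list (True # w) True)))"
      using distinct by (auto simp: fun_eq_iff fun_upd_apply)
    ultimately show ?case
      using "3.prems" distinct unfolding keep_def
      by - (rule runs_While_loop_free[where b = "8 * length w + 1"], simp_all)
  next
    case (4 j w)
    let ?s = "s(r := w, x := True # s x, a := unary j, b := unary (Suc i), z := True # s z)"
    have "runs bb (keep r x z a b) ?s (8 * length w + 1)
        (?s(r := [], x := rev w @ ?s x, z := rev (keep_True j w) @ ?s z,
         a := unary (j - count_list w True), b := unary (Suc i + min j (count_list w True))))"
      by (rule "4.IH") (use distinct "4.prems" in auto)
    moreover have "?s(r := [], x := rev w @ ?s x, z := rev (keep_True j w) @ ?s z,
         a := unary (j - count_list w True), b := unary (Suc i + min j (count_list w True)))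
       = s(r := [], x := rev (True # w) @ s x, z := rev (keep_True (Suc j) (True # w)) @ s z,
         a := unary (Suc j - count_list (True # w) True),
         b := unary (i + min (Suc j) (count_list (True # w) True)))"
      using distinct by (auto simp: fun_eq_iff fun_upd_apply)
    ultimately show ?case
      using "4.prems" distinct unfolding keep_def
      by - (rule runs_While_loop_free[where b = "8 * length w + 1"], simp_all add: unary_Suc)
  qed
qed

text \<open>Each full round takes four bits off \<open>r\<close>; an incomplete last round leaves
  its one to three bits in \<open>z\<close>. The \<open>Skip\<close> branches belong to a top
  \<open>False\<close>, which a unary word never has.\<close>

definition quarter :: "nat \<Rightarrow> nat \<Rightarrow> nat \<Rightarrow> nat \<Rightarrow> prog" where
  "quarter r x y z = While r (Seq (Pop r) (Branch r
     (Push z True) Skip (Seq (Pop r) (Branch r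
     (Seq (Push z True) (Push z True)) Skip (Seq (Pop r) (Branch r
     (Seq (Push z True) (Seq (Push z True) (Push z True))) Skip (Seq (Pop r)
     (Seq (Push y True) (Seq (Push x True) (Seq (Push x True) (Seq (Push x True) (Push x True))))))))))))"

text \<open>Strong induction, as a full round removes four bits. A round costs at most 13 and
  removes at least one bit, whence the rough bound of 13 per bit.\<close>

lemma runs_quarter:
  assumes "distinct [r, x, y, z]" and "s r = unary d" and "s x = unary e" and "s y = unary i"
    and "s z = []"
  shows "runs bb (quarter r x y z) s (13 * d + 1)
    (s(r := [], x := unary (e + 4 * (d div 4)), y := unary (i + d div 4), z := unary (d mod 4)))"
proof -
  have distinct: "distinct [r, x, y, z]" "distinct [z, y, x, r]"
    using assms(1) by auto
  show ?thesis
    using assms(2-)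
  proof (induction d arbitrary: s e i rule: less_induct)
    case (less d)
    have "d = 0 \<or> d = 1 \<or> d = 2 \<or> d = 3 \<or> (\<exists>d'. d = d' + 4)"
      by presburger
    then consider "d = 0" | "d = 1" | "d = 2" | "d = 3" | d' where "d = d' + 4"
      by blast
    then show ?case
    proof cases
      case 1
      with less.prems show ?thesis
        by (auto simp: quarter_def fun_eq_iff fun_upd_apply intro!: runs_While_Nil[unfolded One_nat_def])
    next
      case 5
      have r: "s r = True # True # True # True # unary d'"
        using less.prems(1) 5 by (simp add: unary_def eval_nat_numeral)
      let ?s = "s(r := unary d', y := True # unary i, x := True # True # True # True # unary e)"
      have "runs bb (quarter r x y z) ?s (13 * d' + 1)
        (?s(r := [], x := unary (e + 4 + 4 * (d' div 4)), y := unary (i + 1 + d' div 4),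
          z := unary (d' mod 4)))"
        by (rule less.IH) (use distinct less.prems 5 in \<open>auto simp: unary_def eval_nat_numeral\<close>)
      moreover have "?s(r := [], x := unary (e + 4 + 4 * (d' div 4)), y := unary (i + 1 + d' div 4),
          z := unary (d' mod 4)) = s(r := [], x := unary (e + 4 * (d div 4)), y := unary (i + d div 4),
          z := unary (d mod 4))"
        using distinct 5 by (auto simp: fun_eq_iff fun_upd_apply algebra_simps)
      ultimately have "runs bb (quarter r x y z) s (12 + (13 * d' + 1) + 1) (s(r := [],
          x := unary (e + 4 * (d div 4)), y := unary (i + d div 4), z := unary (d mod 4)))"
        using less.prems(2-) r distinct unfolding quarter_def
        by - (rule runs_While_loop_free[where b = "13 * d' + 1"], simp_all)
      then show ?thesis by (rule runs_mono) (use 5 in simp)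
    next
      case 2
      then have div: "d div 4 = 0" "d mod 4 = 1"
        by simp_all
      have word: "unary 1 = [True]"
        by (simp add: unary_def eval_nat_numeral)
      have "s r = [True]"
        using less.prems(1) 2 word by simp
      moreover have "runs bb (quarter r x y z) (s(r := [], z := [True])) 1
          (s(r := [], z := [True]))"
        unfolding quarter_def by (rule runs_While_empty) (use distinct in simp)
      moreover have "s(r := [], z := [True]) = s(r := [], x := unary (e + 4 * (d div 4)),
          y := unary (i + d div 4), z := unary (d mod 4))"
        using distinct less.prems(2,3) by (auto simp: div word[simplified] fun_eq_iff fun_upd_apply)
      ultimately have "runs bb (quarter r x y z) s (12 + 1 + 1) (s(r := [],
          x := unary (e + 4 * (d div 4)), y := unary (i + d div 4), z := unary (d mod 4)))"
        using less.prems(2-) distinct unfolding quarter_def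
        by - (rule runs_While_loop_free[where b = 1], simp_all)
      then show ?thesis by (rule runs_mono) (use 2 in simp)
    next
      case 3
      then have div: "d div 4 = 0" "d mod 4 = 2"
        by simp_all
      have word: "unary 2 = [True, True]"
        by (simp add: unary_def eval_nat_numeral)
      have "s r = [True, True]"
        using less.prems(1) 3 word by simp
      moreover have "runs bb (quarter r x y z) (s(r := [], z := [True, True])) 1
          (s(r := [], z := [True, True]))"
        unfolding quarter_def by (rule runs_While_empty) (use distinct in simp)
      moreover have "s(r := [], z := [True, True]) = s(r := [], x := unary (e + 4 * (d div 4)),
          y := unary (i + d div 4), z := unary (d mod 4))"
        using distinct less.prems(2,3) by (auto simp: div word[simplified] fun_eq_iff fun_upd_apply)
      ultimately have "runs bb (quarter r x y z) s (12 + 1 + 1) (s(r := [],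
          x := unary (e + 4 * (d div 4)), y := unary (i + d div 4), z := unary (d mod 4)))"
        using less.prems(2-) distinct unfolding quarter_def
        by - (rule runs_While_loop_free[where b = 1], simp_all)
      then show ?thesis by (rule runs_mono) (use 3 in simp)
    next
      case 4
      then have div: "d div 4 = 0" "d mod 4 = 3"
        by simp_all
      have word: "unary 3 = [True, True, True]"
        by (simp add: unary_def eval_nat_numeral)
      have "s r = [True, True, True]"
        using less.prems(1) 4 word by simp
      moreover have "runs bb (quarter r x y z) (s(r := [], z := [True, True, True])) 1
          (s(r := [], z := [True, True, True]))"
        unfolding quarter_def by (rule runs_While_empty) (use distinct in simp)
      moreover have "s(r := [], z := [True, True, True]) = s(r := [], x := unary (e + 4 * (d div 4)),
          y := unary (i + d div 4), z := unary (d mod 4))"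
        using distinct less.prems(2,3) by (auto simp: div word[simplified] fun_eq_iff fun_upd_apply)
      ultimately have "runs bb (quarter r x y z) s (12 + 1 + 1) (s(r := [],
          x := unary (e + 4 * (d div 4)), y := unary (i + d div 4), z := unary (d mod 4)))"
        using less.prems(2-) distinct unfolding quarter_def
        by - (rule runs_While_loop_free[where b = 1], simp_all)
      then show ?thesis by (rule runs_mono) (use 4 in simp)
    qed
  qed
qed

section \<open>The program of the reduction\<close>

text \<open>Reversal spends the budget \<open>k\<close> on the largest elements; the zeros at the
  end extend the ground set by \<open>d\<close> points.\<close>

definition narrow :: "nat \<Rightarrow> nat \<Rightarrow> word \<Rightarrow> word" where
  "narrow k d w = rev (keep_True k (rev w)) @ replicate d False"

lemma length_keep_True [simp]: "length (keep_True j w) = length w"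
  by (induction j w rule: keep_True.induct) auto

lemma length_narrow [simp]: "length (narrow k d w) = length w + d"
  by (simp add: narrow_def)

text \<open>
  With all registers of the given program below \<open>M\<close>, register \<open>M\<close> holds the number \<open>d\<close> of padding
  bits and \<open>M + 1\<close> holds \<open>k\<close>; registers \<open>M + 2\<close> to \<open>M + 4\<close> are scratch space, empty between queries.
\<close>

definition upper :: "nat \<Rightarrow> nat \<Rightarrow> nat \<Rightarrow> state" where
  "upper M d k = (\<lambda>_. [])(M := unary d, M + 1 := unary k)"

section \<open>Simulating a query and converting an answer\<close>

definition select :: "nat \<Rightarrow> nat \<Rightarrow> prog" where
  "select M x = Seq (move x (M + 2)) (Seq (pad M (M + 3) (M + 4)) (Seq (move (M + 3) M)
     (Seq (keep (M + 2) x (M + 4) (M + 1) (M + 3)) (move (M + 3) (M + 1)))))"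

text \<open>A stack is filled from the bottom, so the padding comes first; \<open>keep\<close> then
  reads the reversed copy in \<open>M + 2\<close>, which restores \<open>x\<close> and pushes the
  selected bits in the right order. The padding counter and the consumed budget pass through
  \<open>M + 3\<close> and are moved back.\<close>

lemma runs_select:
  assumes "x < M"
  shows "runs bb (select M x) (with_upper M (upper M d k) s) (16 * length (s x) + 8 * d + 5)
    ((with_upper M (upper M d k) s)(M + 4 := narrow k d (s x)))"
proof -
  let ?w = "s x"
  let ?c = "count_list ?w True"
  define s0 where "s0 = with_upper M (upper M d k) s"
  define s1 where "s1 = s0(x := [], M + 2 := rev ?w)"
  define s2 where "s2 = s1(M := [], M + 3 := unary d, M + 4 := replicate d False)"
  define s3 where "s3 = s2(M + 3 := [], M := unary d)"
  define s4 where "s4 = s3(M + 2 := [], x := ?w, M + 4 := narrow k d ?w,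
    M + 1 := unary (k - ?c), M + 3 := unary (min k ?c))"
  have 1: "runs bb (move x (M + 2)) s0 (4 * length ?w + 1) s1"
    using runs_move[of x "M + 2" bb s0] assms
    by (simp add: s1_def s0_def with_upper_def upper_def)
  have 2: "runs bb (pad M (M + 3) (M + 4)) s1 (4 * d + 1) s2"
    using runs_pad[of M "M + 3" "M + 4" s1 d 0 bb] assms
    by (simp add: s2_def s1_def s0_def with_upper_def upper_def)
  have 3: "runs bb (move (M + 3) M) s2 (4 * d + 1) s3"
    using runs_move[of "M + 3" M bb s2] assms
    by (simp add: s3_def s2_def)
  have 4: "runs bb (keep (M + 2) x (M + 4) (M + 1) (M + 3)) s3 (8 * length ?w + 1) s4"
    using runs_keep[of "M + 2" x "M + 4" "M + 1" "M + 3" s3 "rev ?w" k 0 bb] assms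
    by (simp add: s4_def s3_def s2_def s1_def s0_def with_upper_def upper_def narrow_def)
  have eq: "s4(M + 3 := [], M + 1 := unary k) = s0(M + 4 := narrow k d ?w)"
    using assms by (auto simp: s4_def s3_def s2_def s1_def s0_def with_upper_def upper_def
        fun_eq_iff fun_upd_apply)
  have restore: "min k ?c + (k - ?c) = k"
    by simp
  have "runs bb (move (M + 3) (M + 1)) s4 (4 * min k ?c + 1) (s4(M + 3 := [], M + 1 := unary k))"
    using runs_move[of "M + 3" "M + 1" bb s4] assms
    by (simp add: s4_def restore)
  then have 5: "runs bb (move (M + 3) (M + 1)) s4 (4 * length ?w + 1) (s0(M + 4 := narrow k d ?w))"
    unfolding eq by (rule runs_mono) (use count_le_length[of ?w True] in simp)
  show ?thesis
    unfolding select_def s0_def[symmetric]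
    by (rule runs_mono, rule runs_Seq[OF 1 runs_Seq[OF 2 runs_Seq[OF 3 runs_Seq[OF 4 5]]]]) simp
qed

definition query :: "nat \<Rightarrow> nat \<Rightarrow> nat \<Rightarrow> prog" where
  "query M x y = Seq (select M x) (Seq (Query (M + 4) y) (clear (M + 4)))"

text \<open>Supplies the hypothesis \<open>query\<close> of \<open>runs_subst_query\<close>: the
  word is built in \<open>M + 4\<close>, so \<open>x\<close> keeps its content unless
  \<open>y = x\<close>, and clearing \<open>M + 4\<close> re-establishes the invariant.\<close>

lemma runs_query:
  assumes "x < M" and "y < M" and "bb (narrow k d (s x)) = Some w"
  shows "runs bb (query M x y) (with_upper M (upper M d k) s) (18 * (length (s x) + d) + 7)
    (with_upper M (upper M d k) (s(y := w)))"
proof -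
  let ?s = "(with_upper M (upper M d k) s)(M + 4 := narrow k d (s x))"
  have 1: "runs bb (Query (M + 4) y) ?s 1 (?s(y := w))"
    by (rule runs_Query) (use assms(3) in simp)
  have "?s(y := w, M + 4 := []) = with_upper M (upper M d k) (s(y := w))"
    using assms(2) by (auto simp: with_upper_def upper_def fun_eq_iff fun_upd_apply)
  then have 2: "runs bb (clear (M + 4)) (?s(y := w)) (2 * (length (s x) + d) + 1)
      (with_upper M (upper M d k) (s(y := w)))"
    using runs_clear[of bb "M + 4" "?s(y := w)"] assms(2) by simp
  show ?thesis
    unfolding query_def
    by (rule runs_mono, rule runs_Seq[OF runs_select[OF assms(1)] runs_Seq[OF 1 2]]) simp
qed

definition replace :: "nat \<Rightarrow> nat \<Rightarrow> prog" where
  "replace M x = Seq (select M x) (Seq (clear x) (Seq (move (M + 4) (M + 2)) (move (M + 2) x)))"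

text \<open>Meant for the two output registers. \<open>x\<close> is cleared first because
  \<open>move\<close> pushes onto what is there, and the word is moved twice to keep its
  order.\<close>

lemma runs_replace:
  assumes "x < M"
  shows "runs bb (replace M x) (with_upper M (upper M d k) s) (26 * (length (s x) + d) + 8)
    (with_upper M (upper M d k) (s(x := narrow k d (s x))))"
proof -
  let ?w = "narrow k d (s x)"
  define s0 where "s0 = with_upper M (upper M d k) s"
  define s1 where "s1 = s0(M + 4 := ?w)"
  define s2 where "s2 = s1(x := [])"
  define s3 where "s3 = s2(M + 4 := [], M + 2 := rev ?w)"
  have 1: "runs bb (select M x) s0 (16 * length (s x) + 8 * d + 5) s1"
    unfolding s1_def s0_def by (rule runs_select[OF assms])
  have 2: "runs bb (clear x) s1 (2 * length (s x) + 1) s2"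
    using runs_clear[of bb x s1] assms by (simp add: s2_def s1_def s0_def)
  have 3: "runs bb (move (M + 4) (M + 2)) s2 (4 * (length (s x) + d) + 1) s3"
    using runs_move[of "M + 4" "M + 2" bb s2] assms
    by (simp add: s3_def s2_def s1_def s0_def with_upper_def upper_def)
  have "s3(M + 2 := [], x := ?w) = with_upper M (upper M d k) (s(x := ?w))"
    using assms by (auto simp: s3_def s2_def s1_def s0_def with_upper_def upper_def
        fun_eq_iff fun_upd_apply)
  then have 4: "runs bb (move (M + 2) x) s3 (4 * (length (s x) + d) + 1)
      (with_upper M (upper M d k) (s(x := ?w)))"
    using runs_move[of "M + 2" x bb s3] assms by (simp add: s3_def s2_def)
  show ?thesis
    unfolding replace_def s0_def[symmetric]
    by (rule runs_mono, rule runs_Seq[OF 1 runs_Seq[OF 2 runs_Seq[OF 3 4]]]) simp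
qed

definition setup_quarter :: "nat \<Rightarrow> prog" where
  "setup_quarter M = Seq (move 1 (M + 1)) (Seq (move 0 (M + 2)) (quarter (M + 2) 0 1 M))"

text \<open>The final state is the start of the simulated program on the smaller instance, with the
  upper registers in place; \<open>2 \<le> M\<close> keeps the input registers 0 and 1 below
  \<open>M\<close>.\<close>

lemma runs_setup_quarter:
  assumes "2 \<le> M"
  shows "runs bb (setup_quarter M) (input_state n k) (17 * n + 4 * k + 3)
    (with_upper M (upper M (n mod 4) k) (input_state (4 * (n div 4)) (n div 4)))"
proof -
  define s1 where "s1 = (input_state n k)(1 := [], M + 1 := unary k)"
  define s2 where "s2 = s1(0 := [], M + 2 := unary n)"
  have 1: "runs bb (move 1 (M + 1)) (input_state n k) (4 * k + 1) s1"
    using runs_move[of 1 "M + 1" bb "input_state n k"] assms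
    by (simp add: s1_def input_state_def)
  have 2: "runs bb (move 0 (M + 2)) s1 (4 * n + 1) s2"
    using runs_move[of 0 "M + 2" bb s1] assms
    by (simp add: s2_def s1_def input_state_def)
  have "s2(M + 2 := [], 0 := unary (4 * (n div 4)), 1 := unary (n div 4), M := unary (n mod 4))
      = with_upper M (upper M (n mod 4) k) (input_state (4 * (n div 4)) (n div 4))"
    using assms by (auto simp: s2_def s1_def input_state_def with_upper_def upper_def
        fun_eq_iff fun_upd_apply)
  then have 3: "runs bb (quarter (M + 2) 0 1 M) s2 (13 * n + 1)
      (with_upper M (upper M (n mod 4) k) (input_state (4 * (n div 4)) (n div 4)))"
    using runs_quarter[of "M + 2" 0 1 M s2 n 0 0 bb] assms
    by (simp add: s2_def s1_def input_state_def)
  show ?thesis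
    unfolding setup_quarter_def
    by (rule runs_mono, rule runs_Seq[OF 1 runs_Seq[OF 2 3]]) simp
qed

section \<open>Selecting the largest elements\<close>

text \<open>Inverse of \<open>char_word\<close> on subsets of the ground set; words are indexed from
  0 and elements from 1, whence \<open>i - 1\<close>.\<close>

definition positions :: "word \<Rightarrow> nat set" where
  "positions w = {i. 1 \<le> i \<and> i \<le> length w \<and> w ! (i - 1)}"

lemma length_char_word [simp]: "length (char_word n A) = n"
  by (simp add: char_word_def)

lemma nth_char_word [simp]: "i < n \<Longrightarrow> char_word n A ! i \<longleftrightarrow> Suc i \<in> A"
  by (simp add: char_word_def del: upt_Suc)

lemma char_word_positions: "char_word (length w) (positions w) = w"
  by (rule nth_equalityI) (auto simp: positions_def)

lemma positions_char_word: "A \<subseteq> {1..n} \<Longrightarrow> positions (char_word n A) = A"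
  by (force simp: positions_def)

lemma card_positions: "card (positions w) = count_list w True"
proof -
  have "positions w = Suc ` {i. i < length w \<and> w ! i}"
    by (auto simp: positions_def Suc_le_eq gr0_conv_Suc)
  then have "card (positions w) = card {i. i < length w \<and> w ! i}"
    by (simp add: card_image)
  also have "\<dots> = length (filter (\<lambda>b. b) w)"
    by (simp add: length_filter_conv_card)
  also have "\<dots> = count_list w True"
    by (induction w) auto
  finally show ?thesis .
qed

lemma nth_keep_True: "i < length w \<Longrightarrow> keep_True j w ! i \<Longrightarrow> w ! i"
  by (induction j w arbitrary: i rule: keep_True.induct) (auto simp: nth_Cons split: nat.splits)

lemma count_keep_True: "count_list (keep_True j w) True = min j (count_list w True)"
  by (induction j w rule: keep_True.induct) auto

lemma nth_narrow:
  "i < length w + d \<Longrightarrow>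
    narrow k d w ! i \<longleftrightarrow> i < length w \<and> keep_True k (rev w) ! (length w - Suc i)"
  by (auto simp: narrow_def nth_append rev_nth)

lemma positions_narrow_subset: "positions (narrow k d w) \<subseteq> positions w"
  by (auto simp: positions_def nth_narrow rev_nth dest!: nth_keep_True[rotated])

lemma count_replicate_False: "count_list (replicate d False) True = 0"
  by (induction d) auto

lemma card_positions_narrow: "card (positions (narrow k d w)) = min k (card (positions w))"
  by (simp add: card_positions narrow_def count_keep_True count_replicate_False)

text \<open>Defined through \<open>narrow\<close> to match the computed word by construction; no
  padding, since zeros add no elements.\<close>

definition largest :: "nat \<Rightarrow> nat \<Rightarrow> nat set \<Rightarrow> nat set" where
  "largest n k A = positions (narrow k 0 (char_word n A))"

lemma narrow_char_word: "narrow k d (char_word n A) = char_word (n + d) (largest n k A)"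
proof -
  have "positions (narrow k d (char_word n A)) = largest n k A"
    by (auto simp: largest_def positions_def nth_narrow)
  then show ?thesis
    using char_word_positions[of "narrow k d (char_word n A)"] by simp
qed

lemma largest_subset: "A \<subseteq> {1..n} \<Longrightarrow> largest n k A \<subseteq> A"
  using positions_narrow_subset positions_char_word by (metis largest_def)

lemma largest_vertex:
  assumes "A \<in> schrijver_verts n k" and "k' \<le> k"
  shows "largest n k' A \<in> schrijver_verts (n + d) k'"
proof -
  have A: "A \<subseteq> {1..n}" "card A = k" and stable: "stable n A"
    using assms(1) by (auto simp: schrijver_verts_def stable_def)
  \<comment> \<open>For \<open>d > 0\<close> the last point of the larger ground set lies outside
    \<open>A\<close>, so the cyclic condition is vacuous; for \<open>d = 0\<close> it is the old
    one.\<close>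
  have "n + d \<in> A \<Longrightarrow> d = 0"
    using A(1) by auto
  with stable largest_subset[OF A(1), of k'] have "stable (n + d) (largest n k' A)"
    unfolding stable_def by fastforce
  moreover have "card (largest n k' A) = k'"
    using A assms(2) by (simp add: largest_def card_positions_narrow positions_char_word)
  ultimately show ?thesis
    by (simp add: schrijver_verts_def)
qed

text \<open>Since some vertex must receive a color, this rules out inputs with an empty set of
  colors.\<close>

lemma schrijver_verts_nonempty:
  assumes "0 < k" and "2 * k \<le> n"
  shows "schrijver_verts n k \<noteq> {}"
proof -
  \<comment> \<open>The first \<open>k\<close> odd numbers: the largest, \<open>2 * k - 1\<close>,
    is below \<open>n\<close>, so the cyclic condition holds.\<close>
  let ?A = "(\<lambda>i. 2 * i + 1) ` {..<k}"
  have "stable n ?A"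
    using assms unfolding stable_def by (auto; presburger)
  moreover have "card ?A = k"
    by (subst card_image) (auto simp: inj_on_def)
  ultimately show ?thesis
    unfolding schrijver_verts_def by blast
qed

section \<open>Correctness and running time of the reduction\<close>

lemma poly_nat_mono: "x \<le> y \<Longrightarrow> poly p x \<le> poly p y" for p :: "nat poly"
  by (induction p) (auto intro: mult_le_mono)

theorem theorem1p3:
  assumes "schrijver_poly_time (\<lambda>n k. n = 4 * k) (\<lambda>n k. int n - 2 * int k + 1)"
  shows "schrijver_poly_time (\<lambda>n k. True) (\<lambda>n k. \<lfloor>real n / 2\<rfloor> - 2 * int k + 1)"
proof -
  from assms obtain p :: prog and T :: "nat poly" where p: "\<And>n k c.
      0 < k \<Longrightarrow> 2 * k \<le> n \<Longrightarrow> n = 4 * k \<Longrightarrow>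
      c \<in> schrijver_verts n k \<rightarrow> {1..nat (int n - 2 * int k + 1)} \<Longrightarrow>
      \<exists>t s A B. exec (coloring_black_box n k c) p (input_state n k) t s \<and> t \<le> poly T n \<and>
        s 0 = char_word n A \<and> s 1 = char_word n B \<and> monochromatic_edge n k c A B"
    unfolding schrijver_poly_time_def by blast
  obtain b where "regs p \<subseteq> {..<b}"
    using finite_nat_bounded[OF finite_regs] by blast
  \<comment> \<open>Adding 2 keeps registers 0 and 1 below \<open>M\<close> even if \<open>p\<close>
    does not mention them.\<close>
  define M where "M = b + 2"
  have M: "regs p \<subseteq> {..<M}" "0 < M" "1 < M" "2 \<le> M"
    using \<open>regs p \<subseteq> {..<b}\<close> by (auto simp: M_def)
  define q where "q = Seq (setup_quarter M) (Seq (subst_query (query M) p)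
    (Seq (replace M 0) (replace M 1)))"
  \<comment> \<open>The linear part covers the setup, \<open>17 * n + 4 * k + 3\<close>, and two
    conversions of \<open>26 * n + 8\<close> each, with \<open>4 * k \<le> 2 * n\<close>. A
    simulated step costs at most \<open>18 * n + 7\<close>.\<close>
  define T' where "T' = [:19, 71:] + [:7, 18:] * T"
  have "\<exists>t s A B. exec (coloring_black_box n k c) q (input_state n k) t s \<and> t \<le> poly T' n \<and>
      s 0 = char_word n A \<and> s 1 = char_word n B \<and> monochromatic_edge n k c A B"
    if "0 < k" and "2 * k \<le> n"
      and c: "c \<in> schrijver_verts n k \<rightarrow> {1..nat (\<lfloor>real n / 2\<rfloor> - 2 * int k + 1)}" for n k c
  proof -
    define k' d where "k' = n div 4" and "d = n mod 4"
    have n: "4 * k' + d = n"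
      by (simp add: k'_def d_def)
    have half: "\<lfloor>real n / 2\<rfloor> = int (n div 2)"
      using floor_divide_of_nat_eq[of n 2] by simp
    \<comment> \<open>Some vertex has a color, so the number of colors is at least 1.\<close>
    have "4 * k \<le> n"
    proof -
      obtain A where "A \<in> schrijver_verts n k"
        using schrijver_verts_nonempty[OF \<open>0 < k\<close> \<open>2 * k \<le> n\<close>] by blast
      with c have "c A \<in> {1..nat (\<lfloor>real n / 2\<rfloor> - 2 * int k + 1)}"
        by blast
      then have "1 \<le> nat (int (n div 2) - 2 * int k + 1)"
        unfolding half by simp
      then show ?thesis by linarith
    qed
    then have "k \<le> k'"
      by (simp add: k'_def)
    define f where "f = largest (4 * k') k"
    have vertex: "f A \<in> schrijver_verts n k" if "A \<in> schrijver_verts (4 * k') k'" for A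
      using largest_vertex[OF that \<open>k \<le> k'\<close>, of d] by (simp add: f_def n)
    \<comment> \<open>From \<open>n < 4 * k' + 4\<close> follows
      \<open>n div 2 \<le> 2 * k' + 1\<close>, and \<open>k \<ge> 1\<close> subtracts at least 2; so
      at most \<open>2 * k'\<close> colors occur, where \<open>2 * k' + 1\<close> are
      allowed.\<close>
    have "nat (\<lfloor>real n / 2\<rfloor> - 2 * int k + 1) \<le> nat (int (4 * k') - 2 * int k' + 1)"
      unfolding half using \<open>0 < k\<close> unfolding k'_def by linarith
    with c vertex have "(\<lambda>A. c (f A)) \<in> schrijver_verts (4 * k') k' \<rightarrow>
        {1..nat (int (4 * k') - 2 * int k' + 1)}"
      by (fastforce simp: Pi_iff)
    then obtain t s A B where
      run: "exec (coloring_black_box (4 * k') k' (\<lambda>A. c (f A))) p (input_state (4 * k') k') t s"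
      and t: "t \<le> poly T (4 * k')"
      and s: "s 0 = char_word (4 * k') A" "s 1 = char_word (4 * k') B"
      and edge: "monochromatic_edge (4 * k') k' (\<lambda>A. c (f A)) A B"
      using p[of k' "4 * k'" "\<lambda>A. c (f A)"] \<open>0 < k\<close> \<open>k \<le> k'\<close> by auto
    let ?bb = "coloring_black_box n k c"
    let ?s = "\<lambda>s. with_upper M (upper M d k) s"
    have narrow: "narrow k d (char_word (4 * k') A) = char_word n (f A)" for A
      by (simp add: narrow_char_word f_def n)
    have 1: "runs ?bb (setup_quarter M) (input_state n k) (17 * n + 4 * k + 3)
        (?s (input_state (4 * k') k'))"
      unfolding k'_def d_def by (rule runs_setup_quarter[OF M(4)])
    have 2: "runs ?bb (subst_query (query M) p) (?s (input_state (4 * k') k'))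
        ((18 * n + 7) * t) (?s s)"
    proof (rule runs_subst_query[OF run M(1)])
      fix x y s w
      assume "x < M" "y < M"
        and w: "coloring_black_box (4 * k') k' (\<lambda>A. c (f A)) (s x) = Some w"
      \<comment> \<open>An answered word encodes a vertex of the smaller graph; narrowing it gives a
        vertex of \<open>S(n,k)\<close>, so the given oracle answers too, with the same
        color.\<close>
      from w obtain A where A: "A \<in> schrijver_verts (4 * k') k'" "s x = char_word (4 * k') A"
        by (auto simp: coloring_black_box_def split: if_splits)
      with w have "w = unary (c (f A))"
        by (simp add: coloring_black_box_vertex)
      then have "?bb (narrow k d (s x)) = Some w"
        using A vertex by (simp add: narrow coloring_black_box_vertex)
      from runs_query[of x M y ?bb k d s w, OF \<open>x < M\<close> \<open>y < M\<close> this]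
      show "runs ?bb (query M x y) (?s s) (18 * n + 7) (?s (s(y := w)))"
        by (simp add: A(2) n)
    qed simp
    have 3: "runs ?bb (replace M 0) (?s s) (26 * n + 8) (?s (s(0 := char_word n (f A))))"
      using runs_replace[OF M(2), of ?bb d k s] by (simp add: s narrow n)
    have 4: "runs ?bb (replace M 1) (?s (s(0 := char_word n (f A)))) (26 * n + 8)
        (?s (s(0 := char_word n (f A), 1 := char_word n (f B))))"
      using runs_replace[OF M(3), of ?bb d k "s(0 := char_word n (f A))"]
      by (simp add: s(1) s(2)[unfolded One_nat_def] narrow n)
    have "t \<le> poly T n"
      using t poly_nat_mono[of "4 * k'" n T] n by simp
    then have "(18 * n + 7) * t \<le> (18 * n + 7) * poly T n"
      by (rule mult_le_mono2)
    then have "17 * n + 4 * k + 3 + ((18 * n + 7) * t + (26 * n + 8 + (26 * n + 8))) \<le> poly T' n"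
      using \<open>2 * k \<le> n\<close> by (simp add: T'_def algebra_simps)
    from runs_mono[OF runs_Seq[OF 1 runs_Seq[OF 2 runs_Seq[OF 3 4]]] this]
    obtain t' where t': "t' \<le> poly T' n"
      "exec ?bb q (input_state n k) t' (?s (s(0 := char_word n (f A), 1 := char_word n (f B))))"
      unfolding q_def runs_def by blast
    have AB: "A \<in> schrijver_verts (4 * k') k'" "B \<in> schrijver_verts (4 * k') k'" "A \<inter> B = {}"
      "c (f A) = c (f B)"
      using edge by (auto simp: monochromatic_edge_def schrijver_edges_def)
    have "A \<subseteq> {1..4 * k'}" "B \<subseteq> {1..4 * k'}"
      using AB(1,2) by (simp_all add: schrijver_verts_def stable_def)
    then have "f A \<subseteq> A" "f B \<subseteq> B"
      unfolding f_def by (simp_all only: largest_subset)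
    then have "monochromatic_edge n k c (f A) (f B)"
      using AB vertex by (auto simp: monochromatic_edge_def schrijver_edges_def)
    with t' M show ?thesis
      by (intro exI[of _ t'] exI[of _ "?s (s(0 := char_word n (f A), 1 := char_word n (f B)))"]
          exI[of _ "f A"] exI[of _ "f B"]) simp
  qed
  then show ?thesis
    unfolding schrijver_poly_time_def by blast
qed

end
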